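(* The constraint generation (CG) algorithm described in the context terminates in a finite number of steps. The difference (in objective value) between the returned solution and the global optimal solution of the minimax regret problem $(P)$ is at most $\varepsilon$.
   Context: **Data.** Let $n_x,n_p,n_y,n_d,n_f,n_h\in\mathbb N$, $c\in\mathbb R^{n_x}$, $d\in\mathbb R^{n_d}$, $f\in\mathbb R^{n_f}$, $h\in\mathbb R^{n_h}$, $A\in\mathbb R^{n_p\times n_y}$, $B\in\mathbb R^{n_d\times n_x}$, $C\in\mathbb R^{n_d\times n_y}$, $E\in\mathbb R^{n_f\times n_p}$, $G\in\mathbb R^{n_h\times n_x}$. Vector inequalities are componentwise. **Problem $(P)$** (minimax regret problem): $$\min_x\max_p\min_y\ c^Tx+p^TAy-\min_{x^*,y^*}(c^Tx^*+p^TAy^* )$$ subject to $Bx+Cy\ge d$, $Bx^*+Cy^*\ge d$, $Ep\ge f$, $Gx\ge h$, $x,p,y,x^*,y^*\ge0$, with $x,x^*\in\mathbb R^{n_x}$, $p\in\mathbb R^{n_p}$, $y,y^*\in\mathbb R^{n_y}$. It is reformulated as $$\min_x\max_{p,x^*,y^*}\min_y\ c^Tx+p^TAy-c^Tx^*-p^TAy^*$$ subject to the same constraints. The minimization over $x$ is the first stage, the maximization is the middle stage, and the minimization over $y$ is the second stage. **Relatively complete recourse** (standing assumption): for every first and middle stage decision there is a feasible second stage decision. Dualizing the second stage problem (dual variable $\pi\in\mathbb R^{n_d}$) gives $$\min_x\max_{p,x^*,y^*,\pi}\ c^Tx+(d-Bx)^T\pi-c^Tx^*-p^TAy^*$$ subject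 to $C^T\pi\le A^Tp$, $Bx^*+Cy^*\ge d$, $Ep\ge f$, $Gx\ge h$, $x,p,\pi,x^*,y^*\ge0$. **Subproblem.** Let $$S=\{(p,x^*,y^*,\pi)\in\mathbb R_{\ge0}^{n_p+n_x+n_y+n_d}\mid C^T\pi\le A^Tp,\ Bx^*+Cy^*\ge d,\ Ep\ge f\}.$$ For given $x$, $$SP(x):\quad sp(x)=\max_{(p,x^*,y^*,\pi)\in S}\ (d-Bx)^T\pi-c^Tx^*-p^TAy^*.$$ A solution of $SP(x)$ is always assumed to be chosen in a vertex of the polyhedron $S$ defining the feasible region. **Main problem.** For tuples $(p_l,x_l^*,y_l^*,\pi_l)\in S$, $$MP^{CG}(k):\quad\min_{x,\eta}\ c^Tx+\eta\quad\text{s.t. }\eta\ge(d-Bx)^T\pi_l-c^Tx_l^*-p_l^TAy_l^*\ \ \forall\,1\le l\le k,\quad Gx\ge h,\ x\ge0,\ \eta\in\mathbb R.$$ For $k=0$ there is no constraint bounding $\eta$. Solutions of the main problem are assumed to be obtained at vertices of the polyhedron defining the feasible region. **CG algorithm.** Input $\varepsilon\ge0$ (the predefined solution quality); start with $lb=-\infty$, $ub=+\infty$, $k=0$. Let $(x_0,\eta_0)$ be a solution of $MP^{CG}(0)$ and $(p_1,x_1^*,y_1^*,\pi_1)$ a solution of $SP(x_0)$; set $lb\gets\max\{lb,c^Tx_0+\eta_0\}$, $ub\gets\min\{ub,c^Tx_0+sp(x_0)\}$, $k\gets1$. While $ub-lb>\varepsilon$: let $(x_k,\eta_k)$ be a solution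 of $MP^{CG}(k)$ and $(p_{k+1},x_{k+1}^*,y_{k+1}^*,\pi_{k+1})$ a solution of $SP(x_k)$; set $lb\gets\max\{lb,c^Tx_k+\eta_k\}$, $ub\gets\min\{ub,c^Tx_k+sp(x_k)\}$, $k\gets k+1$. When the loop ends, return $x_{k-1}$, the last computed iterate.
   Formalization: The last iterate's regret can exceed the optimum by more than ε, so the claim is false as stated; proved instead: the last main problem's value c^T x_{k-1}+η_{k-1}, and the regret of any iterate attaining ub (x_{k-1} if it does), are within ε of the optimum. *)

theory Defs
  imports "HOL-Analysis.Analysis"
begin

text \<open>
  Vectors are indexed by finite types, so \<open>real^'y^'p\<close> is a matrix with rows indexed by \<open>'p\<close> and
  columns indexed by \<open>'y\<close>, and \<open>\<le>\<close> on vectors is componentwise. The fields are the data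
  \<open>c, d, f, h, A, B, C, E, G\<close>.
\<close>

record ('x, 'p, 'y, 'd, 'f, 'h) mmr_data =
  vec_c :: "real^'x"
  vec_d :: "real^'d"
  vec_f :: "real^'f"
  vec_h :: "real^'h"
  mat_A :: "real^'y^'p"
  mat_B :: "real^'x^'d"
  mat_C :: "real^'y^'d"
  mat_E :: "real^'p^'f"
  mat_G :: "real^'x^'h"


section \<open>The minimax regret problem\<close>

definition first_stage ::
    "('x::finite, 'p::finite, 'y::finite, 'd::finite, 'f::finite, 'h::finite) mmr_data
      \<Rightarrow> (real^'x) set" where
  "first_stage D = {x. mat_G D *v x \<ge> vec_h D \<and> x \<ge> 0}"

definition uncertainty ::
    "('x::finite, 'p::finite, 'y::finite, 'd::finite, 'f::finite, 'h::finite) mmr_data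
      \<Rightarrow> (real^'p) set" where
  "uncertainty D = {p. mat_E D *v p \<ge> vec_f D \<and> p \<ge> 0}"

definition second_stage ::
    "('x::finite, 'p::finite, 'y::finite, 'd::finite, 'f::finite, 'h::finite) mmr_data
      \<Rightarrow> real^'x \<Rightarrow> (real^'y) set" where
  "second_stage D x = {y. mat_B D *v x + mat_C D *v y \<ge> vec_d D \<and> y \<ge> 0}"

text \<open>The starred decisions are not subject to \<open>G x \<ge> h\<close>.\<close>

definition hindsight ::
    "('x::finite, 'p::finite, 'y::finite, 'd::finite, 'f::finite, 'h::finite) mmr_data
      \<Rightarrow> ((real^'x) \<times> (real^'y)) set" where
  "hindsight D =
     {(xs, ys). mat_B D *v xs + mat_C D *v ys \<ge> vec_d D \<and> xs \<ge> 0 \<and> ys \<ge> 0}"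

definition cost ::
    "('x::finite, 'p::finite, 'y::finite, 'd::finite, 'f::finite, 'h::finite) mmr_data
      \<Rightarrow> real^'p \<Rightarrow> real^'x \<Rightarrow> real^'y \<Rightarrow> real" where
  "cost D p x y = vec_c D \<bullet> x + p \<bullet> (mat_A D *v y)"

definition recourse_value ::
    "('x::finite, 'p::finite, 'y::finite, 'd::finite, 'f::finite, 'h::finite) mmr_data
      \<Rightarrow> real^'x \<Rightarrow> real^'p \<Rightarrow> ereal" where
  "recourse_value D x p = (INF y\<in>second_stage D x. ereal (cost D p x y))"

definition hindsight_value ::
    "('x::finite, 'p::finite, 'y::finite, 'd::finite, 'f::finite, 'h::finite) mmr_data
      \<Rightarrow> real^'p \<Rightarrow> ereal" where
  "hindsight_value D p = (INF (xs, ys)\<in>hindsight D. ereal (cost D p xs ys))"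

text \<open>
  The regret is written as \<open>-(hindsight_value - recourse_value)\<close> because of the extended-real
  convention \<open>-\<infinity> - (-\<infinity>) = \<infinity>\<close>. If for some \<open>p\<close> both inner minima are \<open>-\<infinity>\<close>, this \<open>p\<close> contributes
  \<open>-\<infinity>\<close> to the maximum, exactly as in the form \<open>max\<^sub>p\<^sub>,\<^sub>x\<^sub>*\<^sub>,\<^sub>y\<^sub>* min\<^sub>y\<close> (see
  \<open>max_regret_reformulation\<close> below) and in its dualization; otherwise this is the usual difference.
\<close>

definition max_regret ::
    "('x::finite, 'p::finite, 'y::finite, 'd::finite, 'f::finite, 'h::finite) mmr_data
      \<Rightarrow> real^'x \<Rightarrow> ereal" where
  "max_regret D x = (SUP p\<in>uncertainty D. - (hindsight_value D p - recourse_value D x p))"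

definition minimax_regret ::
    "('x::finite, 'p::finite, 'y::finite, 'd::finite, 'f::finite, 'h::finite) mmr_data
      \<Rightarrow> ereal" where
  "minimax_regret D = (INF x\<in>first_stage D. max_regret D x)"

definition relatively_complete_recourse ::
    "('x::finite, 'p::finite, 'y::finite, 'd::finite, 'f::finite, 'h::finite) mmr_data
      \<Rightarrow> bool" where
  "relatively_complete_recourse D \<longleftrightarrow>
     (\<forall>x\<in>first_stage D. \<forall>p\<in>uncertainty D. \<forall>(xs, ys)\<in>hindsight D. second_stage D x \<noteq> {})"

lemma max_regret_reformulation:
  assumes "hindsight D \<noteq> {}" and "second_stage D x \<noteq> {}"
  shows "max_regret D x =
    (SUP p\<in>uncertainty D. SUP (xs, ys)\<in>hindsight D. INF y\<in>second_stage D x.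
        ereal (cost D p x y - cost D p xs ys))"
proof -
  have "- (hindsight_value D p - recourse_value D x p) =
      (SUP (xs, ys)\<in>hindsight D. INF y\<in>second_stage D x.
        ereal (cost D p x y - cost D p xs ys))" for p
  proof -
    define Q where "Q = recourse_value D x p"
    define g where "g = (\<lambda>z. ereal (cost D p (fst z) (snd z)))"
    obtain y0 where "y0 \<in> second_stage D x"
      using assms(2) by blast
    then have "Q \<le> ereal (cost D p x y0)"
      unfolding Q_def recourse_value_def by (rule INF_lower)
    then have Q: "Q \<noteq> \<infinity>"
      by auto
    have inner: "(INF y\<in>second_stage D x. ereal (cost D p x y - r)) = Q - ereal r" for r
    proof -
      have "(INF y\<in>second_stage D x. ereal (cost D p x y - r)) =
          - (SUP y\<in>second_stage D x. - ereal (cost D p x y - r))"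
        by (simp add: ereal_SUP_uminus_eq del: uminus_ereal.simps)
      also have "(SUP y\<in>second_stage D x. - ereal (cost D p x y - r)) =
          (SUP y\<in>second_stage D x. - ereal (cost D p x y) + ereal r)"
        by (intro SUP_cong refl) simp
      also have "\<dots> = (SUP y\<in>second_stage D x. - ereal (cost D p x y)) + ereal r"
        by (rule SUP_ereal_add_left) (use assms(2) in auto)
      also have "\<dots> = - Q + ereal r"
        unfolding Q_def recourse_value_def
        by (simp add: ereal_SUP_uminus_eq del: uminus_ereal.simps)
      also have "- (- Q + ereal r) = Q - ereal r"
        by (cases Q) auto
      finally show ?thesis .
    qed
    have H: "hindsight_value D p = (INF z\<in>hindsight D. g z)"
      unfolding hindsight_value_def g_def by (simp add: case_prod_beta)
    have "(SUP (xs, ys)\<in>hindsight D. INF y\<in>second_stage D x.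
        ereal (cost D p x y - cost D p xs ys)) = (SUP z\<in>hindsight D. Q - g z)"
      by (simp add: inner g_def case_prod_beta)
    also have "\<dots> = - (hindsight_value D p - Q)"
    proof (cases Q)
      case (real r)
      then have "(SUP z\<in>hindsight D. Q - g z) = Q - (INF z\<in>hindsight D. g z)"
        using SUP_ereal_minus_right[OF assms(1), of Q g] by simp
      then show ?thesis
        using real H by (cases "INF z\<in>hindsight D. g z") auto
    next
      case PInf
      then show ?thesis
        using Q by simp
    next
      case MInf
      then have "(SUP z\<in>hindsight D. Q - g z) = - \<infinity>"
        using assms(1) by (simp add: g_def)
      then show ?thesis
        using MInf by simp
    qed
    finally show ?thesis
      unfolding Q_def by simp
  qed
  then show ?thesis
    unfolding max_regret_def by simp
qed


section \<open>The subproblem\<close>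

text \<open>Tuples are ordered as \<open>(p, x\<^sup>*, y\<^sup>*, \<pi>)\<close>.\<close>

definition sp_feasible ::
    "('x::finite, 'p::finite, 'y::finite, 'd::finite, 'f::finite, 'h::finite) mmr_data
      \<Rightarrow> ((real^'p) \<times> (real^'x) \<times> (real^'y) \<times> (real^'d)) set" where
  "sp_feasible D =
     {(p, xs, ys, \<pi>). p \<ge> 0 \<and> xs \<ge> 0 \<and> ys \<ge> 0 \<and> \<pi> \<ge> 0 \<and>
        transpose (mat_C D) *v \<pi> \<le> transpose (mat_A D) *v p \<and>
        mat_B D *v xs + mat_C D *v ys \<ge> vec_d D \<and>
        mat_E D *v p \<ge> vec_f D}"

definition sp_obj ::
    "('x::finite, 'p::finite, 'y::finite, 'd::finite, 'f::finite, 'h::finite) mmr_data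
      \<Rightarrow> real^'x \<Rightarrow> (real^'p) \<times> (real^'x) \<times> (real^'y) \<times> (real^'d) \<Rightarrow> real" where
  "sp_obj D x = (\<lambda>(p, xs, ys, \<pi>).
     (vec_d D - mat_B D *v x) \<bullet> \<pi> - vec_c D \<bullet> xs - p \<bullet> (mat_A D *v ys))"

definition sp_value ::
    "('x::finite, 'p::finite, 'y::finite, 'd::finite, 'f::finite, 'h::finite) mmr_data
      \<Rightarrow> real^'x \<Rightarrow> ereal" where
  "sp_value D x = (SUP s\<in>sp_feasible D. ereal (sp_obj D x s))"

definition sp_solution ::
    "('x::finite, 'p::finite, 'y::finite, 'd::finite, 'f::finite, 'h::finite) mmr_data
      \<Rightarrow> real^'x \<Rightarrow> (real^'p) \<times> (real^'x) \<times> (real^'y) \<times> (real^'d) \<Rightarrow> bool" where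
  "sp_solution D x s \<longleftrightarrow>
     s extreme_point_of sp_feasible D \<and> (\<forall>s'\<in>sp_feasible D. sp_obj D x s' \<le> sp_obj D x s)"


section \<open>The main problem\<close>

definition mp_feasible ::
    "('x::finite, 'p::finite, 'y::finite, 'd::finite, 'f::finite, 'h::finite) mmr_data
      \<Rightarrow> (nat \<Rightarrow> (real^'p) \<times> (real^'x) \<times> (real^'y) \<times> (real^'d)) \<Rightarrow> nat \<Rightarrow> ((real^'x) \<times> real) set" where
  "mp_feasible D s k = {(x, \<eta>). x \<in> first_stage D \<and> (\<forall>l\<in>{1..k}. \<eta> \<ge> sp_obj D x (s l))}"

text \<open>
  For \<open>k = 0\<close> nothing bounds \<open>\<eta>\<close>, the optimal value is \<open>-\<infinity>\<close>, and the feasible polyhedron contains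
  a line and hence has no vertex. A solution is then any first-stage decision together
  with \<open>\<eta> = -\<infinity>\<close>.
\<close>

definition mp_solution ::
    "('x::finite, 'p::finite, 'y::finite, 'd::finite, 'f::finite, 'h::finite) mmr_data
      \<Rightarrow> (nat \<Rightarrow> (real^'p) \<times> (real^'x) \<times> (real^'y) \<times> (real^'d)) \<Rightarrow> nat \<Rightarrow> real^'x \<Rightarrow> ereal \<Rightarrow> bool" where
  "mp_solution D s k x \<eta> \<longleftrightarrow>
     (if k = 0 then x \<in> first_stage D \<and> \<eta> = - \<infinity>
      else \<exists>r. \<eta> = ereal r \<and> (x, r) extreme_point_of mp_feasible D s k \<and>
             (\<forall>(x', r')\<in>mp_feasible D s k. vec_c D \<bullet> x + r \<le> vec_c D \<bullet> x' + r'))"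


section \<open>The constraint generation algorithm\<close>

text \<open>
  An execution is described by sequences \<open>x\<close>, \<open>\<eta>\<close>, \<open>s\<close>: iteration \<open>k\<close> (counted from 0) computes the
  solution \<open>(x k, \<eta> k)\<close> of the main problem with cuts \<open>s 1, \<dots>, s k\<close> and the solution \<open>s (Suc k)\<close> of
  the subproblem at \<open>x k\<close>. The bounds \<open>cg_lb D x \<eta> k\<close> and \<open>cg_ub D x k\<close> are those held after
  iteration \<open>k\<close>.
\<close>

primrec cg_lb ::
    "('x::finite, 'p::finite, 'y::finite, 'd::finite, 'f::finite, 'h::finite) mmr_data
      \<Rightarrow> (nat \<Rightarrow> real^'x) \<Rightarrow> (nat \<Rightarrow> ereal) \<Rightarrow> nat \<Rightarrow> ereal" where
  "cg_lb D x \<eta> 0 = max (- \<infinity>) (ereal (vec_c D \<bullet> x 0) + \<eta> 0)"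
| "cg_lb D x \<eta> (Suc k) = max (cg_lb D x \<eta> k) (ereal (vec_c D \<bullet> x (Suc k)) + \<eta> (Suc k))"

primrec cg_ub ::
    "('x::finite, 'p::finite, 'y::finite, 'd::finite, 'f::finite, 'h::finite) mmr_data
      \<Rightarrow> (nat \<Rightarrow> real^'x) \<Rightarrow> nat \<Rightarrow> ereal" where
  "cg_ub D x 0 = min \<infinity> (ereal (vec_c D \<bullet> x 0) + sp_value D (x 0))"
| "cg_ub D x (Suc k) = min (cg_ub D x k) (ereal (vec_c D \<bullet> x (Suc k)) + sp_value D (x (Suc k)))"

definition cg_continues ::
    "('x::finite, 'p::finite, 'y::finite, 'd::finite, 'f::finite, 'h::finite) mmr_data
      \<Rightarrow> real \<Rightarrow> (nat \<Rightarrow> real^'x) \<Rightarrow> (nat \<Rightarrow> ereal) \<Rightarrow> nat \<Rightarrow> bool" where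
  "cg_continues D \<epsilon> x \<eta> k \<longleftrightarrow> cg_ub D x k - cg_lb D x \<eta> k > ereal \<epsilon>"

text \<open>Only iterations that are actually executed are constrained.\<close>

definition cg_execution ::
    "('x::finite, 'p::finite, 'y::finite, 'd::finite, 'f::finite, 'h::finite) mmr_data
      \<Rightarrow> real \<Rightarrow> (nat \<Rightarrow> real^'x) \<Rightarrow> (nat \<Rightarrow> ereal)
      \<Rightarrow> (nat \<Rightarrow> (real^'p) \<times> (real^'x) \<times> (real^'y) \<times> (real^'d)) \<Rightarrow> bool" where
  "cg_execution D \<epsilon> x \<eta> s \<longleftrightarrow>
     (\<forall>k. (\<forall>j<k. cg_continues D \<epsilon> x \<eta> j) \<longrightarrow>
        mp_solution D s k (x k) (\<eta> k) \<and> sp_solution D (x k) (s (Suc k)))"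

text \<open>The loop ends after iteration \<open>n\<close>, so \<open>x n\<close> is the last computed iterate.\<close>

definition cg_terminates_at ::
    "('x::finite, 'p::finite, 'y::finite, 'd::finite, 'f::finite, 'h::finite) mmr_data
      \<Rightarrow> real \<Rightarrow> (nat \<Rightarrow> real^'x) \<Rightarrow> (nat \<Rightarrow> ereal) \<Rightarrow> nat \<Rightarrow> bool" where
  "cg_terminates_at D \<epsilon> x \<eta> n \<longleftrightarrow>
     (\<forall>j<n. cg_continues D \<epsilon> x \<eta> j) \<and> \<not> cg_continues D \<epsilon> x \<eta> n"

end

theory Submission
  imports Defs
begin

text \<open>
  Termination: every cut added is an extreme point of the fixed polyhedron \<open>sp_feasible D\<close>, and a
  polyhedron has only finitely many of these. An endless run would therefore produce at some
  iteration \<open>l\<close> an optimal subproblem vertex that is already among the cuts of the main problem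
  solved in iteration \<open>l\<close>. That cut forces \<open>\<eta> l \<ge> sp_value D (x l)\<close>, so the upper bound does not
  exceed the lower bound and the loop stops.

  Quality: the second-stage minimum over \<open>y\<close> is a linear program. It is feasible by relatively
  complete recourse, because the first subproblem solution exhibits a middle-stage decision. By
  strong duality the minimum may be replaced by a maximum over \<open>\<pi>\<close>, and the maximum regret of a
  first-stage decision \<open>x\<close> is \<open>c \<bullet> x + sp_value D x\<close> (\<open>max_regret_eq_sp_value\<close>). Strong duality itself
  (\<open>lp_strong_duality\<close>) comes from separating a point from the closed cone generated by finitely
  many vectors. Consequently each upper bound is the smallest maximum regret among the iterates so
  far. Each main problem keeps only some of the constraints defining \<open>sp_value\<close>, so its optimal
  value is at most \<open>minimax_regret D\<close>. These values do not decrease as cuts are added, hence the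
  final lower bound is the value of the last main problem. The minimax regret lies between the two
  final bounds, which differ by at most \<open>\<epsilon>\<close>.
\<close>


section \<open>Linear programming duality\<close>

text \<open>A form of Farkas' lemma; it rests on the closedness of finitely generated cones.\<close>

lemma farkas_convex_cone_hull:
  fixes S :: "'a::euclidean_space set"
  assumes "finite S" and "z \<notin> convex_cone hull S"
  obtains a where "\<And>g. g \<in> S \<Longrightarrow> 0 \<le> a \<bullet> g" and "a \<bullet> z < 0"
proof -
  obtain a b where az: "a \<bullet> z < b" and ab: "\<And>g. g \<in> convex_cone hull S \<Longrightarrow> b < a \<bullet> g"
    using separating_hyperplane_closed_point[OF convex_convex_cone_hull closed_convex_cone_hull assms(2)]
      assms(1) by blast
  have "b < 0"
    using ab[OF convex_cone_hull_contains_0] by simp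
  have "0 \<le> a \<bullet> g" if "g \<in> S" for g
  proof (rule ccontr)
    assume neg: "\<not> 0 \<le> a \<bullet> g"
    \<comment> \<open>The positive multiple of \<open>g\<close> on which \<open>a\<close> takes the value \<open>b\<close> still lies in the cone.\<close>
    have "(b / (a \<bullet> g)) *\<^sub>R g \<in> convex_cone hull S"
      using neg \<open>b < 0\<close> that by (intro convex_cone_hull_mul hull_inc) (auto simp: divide_nonpos_neg)
    from ab[OF this] neg show False
      by simp
  qed
  with az \<open>b < 0\<close> show thesis
    by (intro that[of a]) auto
qed

lemma inner_mono_nonneg_vec:
  fixes a b c :: "real^'n"
  assumes "a \<le> b" and "0 \<le> c"
  shows "a \<bullet> c \<le> b \<bullet> c"
  using assms by (auto simp: inner_vec_def less_eq_vec_def intro!: sum_mono mult_right_mono)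

lemma inner_transpose_matrix_vector:
  fixes M :: "real^'n^'m"
  shows "(transpose M *v u) \<bullet> w = u \<bullet> (M *v w)"
  by (simp add: transpose_matrix_vector dot_lmul_matrix)

text \<open>
  The primal program is to minimize \<open>q \<bullet> w\<close> subject to \<open>b \<le> M *v w\<close> and \<open>0 \<le> w\<close>; the dual is to
  maximize \<open>b \<bullet> u\<close> subject to \<open>transpose M *v u \<le> q\<close> and \<open>0 \<le> u\<close>.
\<close>

lemma lp_weak_duality:
  fixes M :: "real^'n^'m"
  assumes "transpose M *v u \<le> q" "0 \<le> u" "b \<le> M *v w" "0 \<le> w"
  shows "b \<bullet> u \<le> q \<bullet> w"
proof -
  have "b \<bullet> u \<le> (M *v w) \<bullet> u"
    using assms by (intro inner_mono_nonneg_vec)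
  also have "\<dots> = (transpose M *v u) \<bullet> w"
    by (subst inner_transpose_matrix_vector) (rule inner_commute)
  also have "\<dots> \<le> q \<bullet> w"
    using assms by (intro inner_mono_nonneg_vec)
  finally show ?thesis .
qed

text \<open>
  A bound \<open>v\<close> valid at all feasible points of the primal, if there are any, is certified by a dual
  feasible point. In the product space, the cone generated by the rows \<open>(row i M, b $ i)\<close>, the
  slack directions \<open>(axis j 1, 0)\<close> and \<open>(0, -1)\<close> consists of the pairs \<open>(q', v')\<close> such that some
  dual feasible point for the cost vector \<open>q'\<close> has value at least \<open>v'\<close>. If \<open>(q, v)\<close> lies outside
  of it, a separating vector \<open>(y, t)\<close> gives a primal point, or a primal ray if \<open>t = 0\<close>, that
  contradicts the bound \<open>v\<close>.
\<close>

lemma lp_strong_duality: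
  fixes M :: "real^'n^'m" and b :: "real^'m" and q :: "real^'n" and v :: real
  assumes feas: "b \<le> M *v w0" "0 \<le> w0"
    and bound: "\<And>w. b \<le> M *v w \<Longrightarrow> 0 \<le> w \<Longrightarrow> v \<le> q \<bullet> w"
  obtains u where "0 \<le> u" and "transpose M *v u \<le> q" and "v \<le> b \<bullet> u"
proof -
  define R where "R = {(q', v'). \<exists>u\<ge>0. transpose M *v u \<le> q' \<and> v' \<le> b \<bullet> u}"
  define S where "S = range (\<lambda>i. (row i M, b $ i)) \<union> range (\<lambda>j. (axis j 1, 0)) \<union> {(0, -1)}"
  have RI: "(q', v') \<in> R" if "0 \<le> u" "transpose M *v u \<le> q'" "v' \<le> b \<bullet> u" for q' v' u
    using that unfolding R_def by auto
  have "convex_cone R"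
    unfolding convex_cone_iff
  proof (intro conjI ballI allI impI)
    show "0 \<in> R"
      unfolding zero_prod_def by (rule RI[of 0]) (auto simp: less_eq_vec_def)
  next
    fix z z' assume "z \<in> R" "z' \<in> R"
    then obtain u u' where
      "0 \<le> u" "transpose M *v u \<le> fst z" "snd z \<le> b \<bullet> u"
      "0 \<le> u'" "transpose M *v u' \<le> fst z'" "snd z' \<le> b \<bullet> u'"
      unfolding R_def by auto
    then have "(fst z + fst z', snd z + snd z') \<in> R"
      by (intro RI[of "u + u'"])
        (auto simp: matrix_vector_right_distrib inner_add_right intro: add_mono)
    then show "z + z' \<in> R"
      by (simp add: plus_prod_def)
  next
    fix z and t :: real assume "z \<in> R" "0 \<le> t"
    then obtain u where "0 \<le> u" "transpose M *v u \<le> fst z" "snd z \<le> b \<bullet> u"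
      unfolding R_def by auto
    with \<open>0 \<le> t\<close> have "(t *\<^sub>R fst z, t *\<^sub>R snd z) \<in> R"
      by (intro RI[of "t *\<^sub>R u"])
        (auto simp: less_eq_vec_def matrix_vector_mult_scaleR mult_left_mono)
    then show "t *\<^sub>R z \<in> R"
      by (simp add: scaleR_prod_def)
  qed
  moreover have "S \<subseteq> R"
  proof -
    have "(row i M, b $ i) \<in> R" for i
      by (rule RI[of "axis i 1"])
        (auto simp: less_eq_vec_def axis_def inner_axis row_def column_def
          matrix_vector_mul_component inner_vec_def transpose_def if_distrib cong: if_cong)
    moreover have "(axis j 1, 0) \<in> R" "(0, -1) \<in> R" for j
      by (rule RI[of 0]; auto simp: less_eq_vec_def axis_def)+
    ultimately show ?thesis
      unfolding S_def by auto
  qed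
  ultimately have hull: "convex_cone hull S \<subseteq> R"
    by (intro hull_minimal)
  show thesis
  proof (cases "(q, v) \<in> convex_cone hull S")
    case True
    with hull have "(q, v) \<in> R" ..
    then show thesis
      unfolding R_def using that by blast
  next
    case False
    have "finite S"
      unfolding S_def by auto
    from farkas_convex_cone_hull[OF this False]
    obtain a where a: "\<And>g. g \<in> S \<Longrightarrow> 0 \<le> a \<bullet> g" "a \<bullet> (q, v) < 0"
      by blast
    obtain y t where yt: "a = (y, t)"
      by (cases a)
    have row: "0 \<le> (M *v y) $ i + t * b $ i" for i
      using a(1)[of "(row i M, b $ i)"] unfolding S_def yt
      by (simp add: matrix_vector_mul_component row_def inner_commute)
    have y: "0 \<le> y"
      unfolding less_eq_vec_def using a(1)[of "(axis _ 1, 0)"] unfolding S_def yt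
      by (auto simp: inner_axis)
    have t: "t \<le> 0"
      using a(1)[of "(0, -1)"] unfolding S_def yt by simp
    have qv: "q \<bullet> y + t * v < 0"
      using a(2) unfolding yt by (simp add: inner_commute mult.commute)
    show thesis
    proof (cases "t = 0")
      case True
      \<comment> \<open>Then \<open>y\<close> is a feasible ray of negative cost. Following it from \<open>w0\<close> far enough
        undercuts \<open>v\<close>.\<close>
      define r where "r = max 0 ((v - 1 - q \<bullet> w0) / (q \<bullet> y))"
      have "q \<bullet> y < 0"
        using qv True by simp
      have "v \<le> q \<bullet> (w0 + r *\<^sub>R y)"
      proof (rule bound)
        show "0 \<le> w0 + r *\<^sub>R y"
          using feas(2) y by (auto simp: less_eq_vec_def r_def)
        have "0 \<le> r * (M *v y) $ i" for i
          using row[of i] True by (simp add: r_def)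
        with feas(1) show "b \<le> M *v (w0 + r *\<^sub>R y)"
          by (auto simp: less_eq_vec_def matrix_vector_right_distrib matrix_vector_mult_scaleR
              intro: add_increasing2)
      qed
      also have "\<dots> = q \<bullet> w0 + r * (q \<bullet> y)"
        by (simp add: inner_add_right)
      also have "r * (q \<bullet> y) \<le> (v - 1 - q \<bullet> w0) / (q \<bullet> y) * (q \<bullet> y)"
        using \<open>q \<bullet> y < 0\<close> by (intro mult_right_mono_neg) (auto simp: r_def)
      also have "\<dots> = v - 1 - q \<bullet> w0"
        using \<open>q \<bullet> y < 0\<close> by simp
      finally show thesis
        by simp
    next
      case False
      with t have "t < 0"
        by simp
      \<comment> \<open>Rescaling to last component \<open>-1\<close> turns \<open>y\<close> into a feasible point of cost below \<open>v\<close>.\<close>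
      have "v \<le> q \<bullet> ((1 / - t) *\<^sub>R y)"
      proof (rule bound)
        show "0 \<le> (1 / - t) *\<^sub>R y"
          using y \<open>t < 0\<close> by (auto simp: less_eq_vec_def divide_nonneg_neg)
        show "b \<le> M *v ((1 / - t) *\<^sub>R y)"
          unfolding less_eq_vec_def matrix_vector_mult_scaleR
        proof
          fix i
          show "b $ i \<le> ((1 / - t) *\<^sub>R (M *v y)) $ i"
            using row[of i] \<open>t < 0\<close> by (simp add: field_simps)
        qed
      qed
      then show thesis
        using qv \<open>t < 0\<close> by (simp add: field_simps)
    qed
  qed
qed


section \<open>The subproblem polyhedron\<close>

lemma polyhedron_linear_ge:
  fixes f :: "'a::euclidean_space \<Rightarrow> real^'n"
  assumes "linear f"
  shows "polyhedron {z. b \<le> f z}"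
proof -
  have "f z $ i = adjoint f (axis i 1) \<bullet> z" for z i
    using adjoint_works[OF assms, of z "axis i 1"] by (simp add: inner_axis inner_commute)
  then have "{z. b \<le> f z} = (\<Inter>i. {z. adjoint f (axis i 1) \<bullet> z \<ge> b $ i})"
    by (auto simp: less_eq_vec_def)
  also have "polyhedron \<dots>"
    by (intro polyhedron_Inter) (auto intro: polyhedron_halfspace_ge)
  finally show ?thesis .
qed

lemma polyhedron_sp_feasible: "polyhedron (sp_feasible D)"
proof -
  have "sp_feasible D =
      {z. 0 \<le> fst z} \<inter> {z. 0 \<le> fst (snd z)} \<inter> {z. 0 \<le> fst (snd (snd z))} \<inter>
      {z. 0 \<le> snd (snd (snd z))} \<inter>
      {z. 0 \<le> transpose (mat_A D) *v fst z - transpose (mat_C D) *v snd (snd (snd z))} \<inter>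
      {z. vec_d D \<le> mat_B D *v fst (snd z) + mat_C D *v fst (snd (snd z))} \<inter>
      {z. vec_f D \<le> mat_E D *v fst z}"
    unfolding sp_feasible_def by auto
  also have "polyhedron \<dots>"
    by (intro polyhedron_Int polyhedron_linear_ge linearI)
      (simp_all add: matrix_vector_right_distrib matrix_vector_mult_scaleR algebra_simps)
  finally show ?thesis .
qed


section \<open>Maximum regret as the value of the subproblem\<close>

lemma max_regret_ge_sp_obj:
  assumes "second_stage D x \<noteq> {}" and "s \<in> sp_feasible D"
  shows "ereal (vec_c D \<bullet> x + sp_obj D x s) \<le> max_regret D x"
proof -
  obtain p xs ys \<pi> where s: "s = (p, xs, ys, \<pi>)"
    by (cases s)
  have f: "0 \<le> \<pi>" "transpose (mat_C D) *v \<pi> \<le> transpose (mat_A D) *v p"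
      and p: "p \<in> uncertainty D" and h: "(xs, ys) \<in> hindsight D"
    using assms(2) unfolding s sp_feasible_def uncertainty_def hindsight_def by auto
  have "ereal (vec_c D \<bullet> x + sp_obj D x s) \<le> ereal (cost D p x y - cost D p xs ys)"
    if "y \<in> second_stage D x" for y
  proof -
    have "vec_d D - mat_B D *v x \<le> mat_C D *v y" "0 \<le> y"
      using that unfolding second_stage_def by (auto simp: less_eq_vec_def algebra_simps)
    from lp_weak_duality[OF f(2,1) this] show ?thesis
      unfolding s sp_obj_def cost_def inner_transpose_matrix_vector by simp
  qed
  then have "ereal (vec_c D \<bullet> x + sp_obj D x s) \<le>
      (INF y\<in>second_stage D x. ereal (cost D p x y - cost D p xs ys))"
    by (rule INF_greatest)
  also have "\<dots> \<le> (SUP (xs, ys)\<in>hindsight D. INF y\<in>second_stage D x.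
      ereal (cost D p x y - cost D p xs ys))"
    using h by (auto intro: SUP_upper2)
  also have "\<dots> \<le> max_regret D x"
    using h assms(1) p by (subst max_regret_reformulation) (auto intro: SUP_upper2)
  finally show ?thesis .
qed

text \<open>
  Both sides may be infinite. In the inequality from left to right, a pair of \<open>p\<close> and hindsight
  decision for which the second stage is unbounded contributes \<open>-\<infinity>\<close> and needs no dual solution.
\<close>

lemma max_regret_eq_sp_value:
  assumes "hindsight D \<noteq> {}" and "second_stage D x \<noteq> {}"
  shows "max_regret D x = ereal (vec_c D \<bullet> x) + sp_value D x"
proof (rule antisym)
  show "ereal (vec_c D \<bullet> x) + sp_value D x \<le> max_regret D x"
  proof -
    have "sp_value D x \<le> max_regret D x - ereal (vec_c D \<bullet> x)"
      unfolding sp_value_def using max_regret_ge_sp_obj[OF assms(2)]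
      by (intro SUP_least) (simp add: ereal_le_minus add.commute)
    then show ?thesis
      by (simp add: ereal_le_minus add.commute)
  qed
  have "(INF y\<in>second_stage D x. ereal (cost D p x y - cost D p xs ys))
      \<le> ereal (vec_c D \<bullet> x) + sp_value D x" (is "?I \<le> _")
    if p: "p \<in> uncertainty D" and h: "(xs, ys) \<in> hindsight D" for p xs ys
  proof (cases ?I)
    case MInf
    then show ?thesis
      by simp
  next
    case PInf
    obtain y0 where "y0 \<in> second_stage D x"
      using assms(2) by blast
    then have "?I \<le> ereal (cost D p x y0 - cost D p xs ys)"
      by (rule INF_lower)
    with PInf show ?thesis
      by simp
  next
    case (real r)
    have sec: "y \<in> second_stage D x \<longleftrightarrow> vec_d D - mat_B D *v x \<le> mat_C D *v y \<and> 0 \<le> y" for y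
      unfolding second_stage_def by (auto simp: less_eq_vec_def algebra_simps)
    obtain y0 where y0: "vec_d D - mat_B D *v x \<le> mat_C D *v y0" "0 \<le> y0"
      using assms(2) sec by blast
    have "r - vec_c D \<bullet> x + cost D p xs ys \<le> (transpose (mat_A D) *v p) \<bullet> y"
      if "vec_d D - mat_B D *v x \<le> mat_C D *v y" "0 \<le> y" for y
    proof -
      have "?I \<le> ereal (cost D p x y - cost D p xs ys)"
        using that sec by (intro INF_lower) blast
      then show ?thesis
        unfolding real by (simp add: cost_def inner_transpose_matrix_vector del: transpose_matrix_vector)
    qed
    from lp_strong_duality[OF y0 this] obtain \<pi> where \<pi>:
      "0 \<le> \<pi>" "transpose (mat_C D) *v \<pi> \<le> transpose (mat_A D) *v p"
      "r - vec_c D \<bullet> x + cost D p xs ys \<le> (vec_d D - mat_B D *v x) \<bullet> \<pi>"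
      by blast
    have "(p, xs, ys, \<pi>) \<in> sp_feasible D"
      using p h \<pi> unfolding sp_feasible_def uncertainty_def hindsight_def by simp
    then have "ereal (sp_obj D x (p, xs, ys, \<pi>)) \<le> sp_value D x"
      unfolding sp_value_def by (rule SUP_upper)
    moreover have "r \<le> vec_c D \<bullet> x + sp_obj D x (p, xs, ys, \<pi>)"
      using \<pi>(3) by (simp add: sp_obj_def cost_def)
    ultimately show ?thesis
      unfolding real by (cases "sp_value D x") auto
  qed
  then show "max_regret D x \<le> ereal (vec_c D \<bullet> x) + sp_value D x"
    unfolding max_regret_reformulation[OF assms] by (auto intro!: SUP_least)
qed

lemma sp_value_sp_solution:
  assumes "sp_solution D x s"
  shows "sp_value D x = ereal (sp_obj D x s)"
  unfolding sp_value_def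
proof (rule antisym)
  show "(SUP s\<in>sp_feasible D. ereal (sp_obj D x s)) \<le> ereal (sp_obj D x s)"
    using assms unfolding sp_solution_def by (intro SUP_least) auto
  show "ereal (sp_obj D x s) \<le> (SUP s\<in>sp_feasible D. ereal (sp_obj D x s))"
    using assms unfolding sp_solution_def extreme_point_of_def by (intro SUP_upper) auto
qed


section \<open>The bounds maintained by the algorithm\<close>

lemma cg_lb_ge: "j \<le> n \<Longrightarrow> ereal (vec_c D \<bullet> x j) + \<eta> j \<le> cg_lb D x \<eta> n"
  by (induction n) (auto simp: le_Suc_eq intro: max.coboundedI1)

lemma cg_lb_le: "(\<And>j. j \<le> n \<Longrightarrow> ereal (vec_c D \<bullet> x j) + \<eta> j \<le> z) \<Longrightarrow> cg_lb D x \<eta> n \<le> z"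
  by (induction n) auto

lemma cg_ub_le: "j \<le> n \<Longrightarrow> cg_ub D x n \<le> ereal (vec_c D \<bullet> x j) + sp_value D (x j)"
  by (induction n) (auto simp: le_Suc_eq intro: min.coboundedI1)

lemma cg_ub_attained: "\<exists>j\<le>n. cg_ub D x n = ereal (vec_c D \<bullet> x j) + sp_value D (x j)"
proof (induction n)
  case 0
  then show ?case
    by (simp add: min_def)
next
  case (Suc n)
  then show ?case
    by (cases "cg_ub D x n \<le> ereal (vec_c D \<bullet> x (Suc n)) + sp_value D (x (Suc n))")
      (auto simp: min_def intro: le_SucI)
qed

lemma mp_solution_first_stage:
  "mp_solution D s k x \<eta> \<Longrightarrow> x \<in> first_stage D"
  by (auto simp: mp_solution_def mp_feasible_def extreme_point_of_def split: if_splits)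

lemma mp_solution_ge_cut:
  assumes "mp_solution D s k x \<eta>" and "l \<in> {1..k}"
  shows "ereal (sp_obj D x (s l)) \<le> \<eta>"
  using assms by (auto simp: mp_solution_def mp_feasible_def extreme_point_of_def)

text \<open>
  Optimality of the main problem with the epigraph variable taken in the extended reals; this
  covers \<open>k = 0\<close>, where the optimal value is \<open>-\<infinity>\<close>.
\<close>

lemma mp_solution_le:
  assumes "mp_solution D s k x \<eta>" and "x' \<in> first_stage D"
    and "\<And>l. l \<in> {1..k} \<Longrightarrow> ereal (sp_obj D x' (s l)) \<le> \<eta>'"
  shows "ereal (vec_c D \<bullet> x) + \<eta> \<le> ereal (vec_c D \<bullet> x') + \<eta>'"
proof (cases "k = 0")
  case True
  then show ?thesis
    using assms(1) by (simp add: mp_solution_def)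
next
  case False
  then have "1 \<in> {1..k}"
    by simp
  from assms(3)[OF this] show ?thesis
    using False assms by (cases \<eta>') (auto simp: mp_solution_def mp_feasible_def)
qed


section \<open>Termination and solution quality\<close>

theorem theorem1:
  fixes D :: "('x::finite, 'p::finite, 'y::finite, 'd::finite, 'f::finite, 'h::finite) mmr_data"
    and \<epsilon> :: real
    and x :: "nat \<Rightarrow> real^'x"
    and \<eta> :: "nat \<Rightarrow> ereal"
    and s :: "nat \<Rightarrow> (real^'p) \<times> (real^'x) \<times> (real^'y) \<times> (real^'d)"
  assumes "relatively_complete_recourse D"
    and "\<epsilon> \<ge> 0"
    and "cg_execution D \<epsilon> x \<eta> s"
  shows "\<exists>n. cg_terminates_at D \<epsilon> x \<eta> n \<and>
           x n \<in> first_stage D \<and>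
           \<bar>ereal (vec_c D \<bullet> x n) + \<eta> n - minimax_regret D\<bar> \<le> ereal \<epsilon> \<and>
           (\<exists>j\<le>n. max_regret D (x j) = cg_ub D x n) \<and>
           (\<forall>j\<le>n. max_regret D (x j) = cg_ub D x n \<longrightarrow>
              \<bar>max_regret D (x j) - minimax_regret D\<bar> \<le> ereal \<epsilon>)"
proof -
  have step: "mp_solution D s k (x k) (\<eta> k)" "sp_solution D (x k) (s (Suc k))"
    if "\<And>j. j < k \<Longrightarrow> cg_continues D \<epsilon> x \<eta> j" for k
    using assms(3) that unfolding cg_execution_def by blast+
  have s1: "s 1 \<in> sp_feasible D"
    using step(2)[of 0] by (simp add: sp_solution_def extreme_point_of_def)
  then obtain p xs ys where p: "p \<in> uncertainty D" and h: "(xs, ys) \<in> hindsight D"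
    unfolding sp_feasible_def uncertainty_def hindsight_def by auto
  have second: "second_stage D x' \<noteq> {}" if "x' \<in> first_stage D" for x'
    using assms(1) p h that unfolding relatively_complete_recourse_def by blast
  have regret: "max_regret D x' = ereal (vec_c D \<bullet> x') + sp_value D x'"
    if "x' \<in> first_stage D" for x'
    using h second[OF that] by (intro max_regret_eq_sp_value) auto

  have "\<exists>n. \<not> cg_continues D \<epsilon> x \<eta> n"
  proof (rule ccontr)
    assume "\<not> ?thesis"
    then have cont: "cg_continues D \<epsilon> x \<eta> n" for n
      by blast
    have "range (\<lambda>k. s (Suc k)) \<subseteq> {v. v extreme_point_of sp_feasible D}"
      using step(2) cont unfolding sp_solution_def by auto
    then have "finite (range (\<lambda>k. s (Suc k)))"
      using finite_polyhedron_extreme_points[OF polyhedron_sp_feasible] finite_subset by blast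
    then have "\<not> inj (\<lambda>k. s (Suc k))"
      using finite_imageD by blast
    then obtain k l where "k < l" and eq: "s (Suc k) = s (Suc l)"
      unfolding inj_def by (metis linorder_neqE_nat)
    \<comment> \<open>The optimal subproblem vertex at \<open>x l\<close> is already a cut of the main problem solved there.\<close>
    have "sp_value D (x l) = ereal (sp_obj D (x l) (s (Suc k)))"
      using sp_value_sp_solution[OF step(2)] cont eq by simp
    also have "\<dots> \<le> \<eta> l"
      using mp_solution_ge_cut[OF step(1)] cont \<open>k < l\<close> by simp
    finally have "ereal (vec_c D \<bullet> x l) + sp_value D (x l) \<le> ereal (vec_c D \<bullet> x l) + \<eta> l"
      by (rule add_left_mono)
    then have "cg_ub D x l \<le> cg_lb D x \<eta> l"
      using cg_ub_le[of l l D x] cg_lb_ge[of l l D x \<eta>] by simp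
    moreover obtain u where "cg_ub D x l = ereal u"
      using cg_ub_attained[of l D x] sp_value_sp_solution[OF step(2)] cont by auto
    ultimately have "cg_ub D x l - cg_lb D x \<eta> l \<le> ereal \<epsilon>"
      using assms(2) by (cases "cg_ub D x l"; cases "cg_lb D x \<eta> l") auto
    with cont[of l] show False
      unfolding cg_continues_def by simp
  qed
  then obtain n where stop: "\<not> cg_continues D \<epsilon> x \<eta> n"
    and before: "\<And>j. j < n \<Longrightarrow> cg_continues D \<epsilon> x \<eta> j"
    using exists_least_iff[of "\<lambda>n. \<not> cg_continues D \<epsilon> x \<eta> n"] by blast
  have mp: "mp_solution D s j (x j) (\<eta> j)" and sp: "sp_solution D (x j) (s (Suc j))"
    if "j \<le> n" for j
    using step[of j] before that by auto
  have xj: "x j \<in> first_stage D" if "j \<le> n" for j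
    using mp_solution_first_stage[OF mp[OF that]] .
  have sf: "s l \<in> sp_feasible D" if "l \<in> {1..n}" for l
    using sp[of "l - 1"] that by (auto simp: sp_solution_def extreme_point_of_def)
  have regret_j: "max_regret D (x j) = ereal (vec_c D \<bullet> x j) + sp_value D (x j)" if "j \<le> n" for j
    using regret[OF xj[OF that]] .

  \<comment> \<open>The last main problem has all the cuts of the earlier ones, so its value is the largest.\<close>
  define lb where "lb = ereal (vec_c D \<bullet> x n) + \<eta> n"
  have "cg_lb D x \<eta> n \<le> lb"
    unfolding lb_def
  proof (rule cg_lb_le)
    fix j assume "j \<le> n"
    then show "ereal (vec_c D \<bullet> x j) + \<eta> j \<le> ereal (vec_c D \<bullet> x n) + \<eta> n"
      by (intro mp_solution_le[OF mp] xj mp_solution_ge_cut[OF mp]) auto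
  qed
  moreover have "lb \<le> cg_lb D x \<eta> n"
    unfolding lb_def by (rule cg_lb_ge) simp
  ultimately have lb_eq: "cg_lb D x \<eta> n = lb"
    by (rule antisym)

  have "lb \<le> minimax_regret D"
    unfolding minimax_regret_def
  proof (rule INF_greatest)
    fix x' assume x': "x' \<in> first_stage D"
    have "lb \<le> ereal (vec_c D \<bullet> x') + sp_value D x'"
      unfolding lb_def sp_value_def
      by (intro mp_solution_le[OF mp] x') (auto intro!: SUP_upper sf)
    then show "lb \<le> max_regret D x'"
      using regret[OF x'] by simp
  qed
  obtain i where i: "i \<le> n" "cg_ub D x n = max_regret D (x i)"
    using cg_ub_attained[of n D x] regret_j by metis
  have "minimax_regret D \<le> cg_ub D x n"
    unfolding i(2) minimax_regret_def using xj[OF i(1)] by (rule INF_lower)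
  have "cg_ub D x n - lb \<le> ereal \<epsilon>"
    using stop unfolding cg_continues_def lb_eq by simp
  moreover obtain u where u: "cg_ub D x n = ereal u"
    using i regret_j sp_value_sp_solution[OF sp] by simp
  ultimately obtain l where l: "lb = ereal l"
    using \<open>lb \<le> minimax_regret D\<close> \<open>minimax_regret D \<le> cg_ub D x n\<close>
    by (cases lb) auto
  obtain m where m: "minimax_regret D = ereal m"
    using \<open>lb \<le> minimax_regret D\<close> \<open>minimax_regret D \<le> cg_ub D x n\<close> u l
    by (cases "minimax_regret D") auto
  have lmu: "l \<le> m" "m \<le> u" "u - l \<le> \<epsilon>"
    using \<open>lb \<le> minimax_regret D\<close> \<open>minimax_regret D \<le> cg_ub D x n\<close>
      \<open>cg_ub D x n - lb \<le> ereal \<epsilon>\<close> unfolding u l m by simp_all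
  show ?thesis
  proof (rule exI[of _ n], intro conjI allI impI)
    show "cg_terminates_at D \<epsilon> x \<eta> n"
      using stop before unfolding cg_terminates_at_def by blast
    show "x n \<in> first_stage D"
      by (rule xj) simp
    show "\<bar>ereal (vec_c D \<bullet> x n) + \<eta> n - minimax_regret D\<bar> \<le> ereal \<epsilon>"
      using lmu l m unfolding lb_def by simp
    show "\<exists>j\<le>n. max_regret D (x j) = cg_ub D x n"
      using i by metis
    show "\<bar>max_regret D (x j) - minimax_regret D\<bar> \<le> ereal \<epsilon>"
      if "j \<le> n" "max_regret D (x j) = cg_ub D x n" for j
      using lmu unfolding that(2) u m by simp
  qed
qed

end
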